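(* For any group $G$ and any integer $n\ge1$ there is an isomorphism $$(G\wr_n\mathbb{Z})\big/\left[G\wr_n\mathbb{Z},\,G\wr_n\mathbb{Z}\right]\cong G/[G,G]\times\mathbb{Z}.$$
   Context: For a group $G$ and $n\ge 1$, $G\wr_n\mathbb{Z}$ is the semidirect product $G^n\rtimes\mathbb{Z}$ with respect to the action of $\mathbb{Z}$ on $G^n$ by cyclic shifts of coordinates. Its elements are written $(g_1,\dots,g_n,k)$ with $g_i\in G$, $k\in\mathbb{Z}$, and the multiplication is $(a_1,\dots,a_n,k)(b_1,\dots,b_n,p)=(a_{1+p}b_1,a_{2+p}b_2,\dots,a_{n+p}b_n,k+p)$, indices taken modulo $n$. $[H,H]$ denotes the commutator subgroup of a group $H$. *)

theory Defs
  imports "HOL-Algebra.Generated_Groups" "HOL-Algebra.Product_Groups"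
    "HOL-Algebra.Elementary_Groups"
begin

text \<open>The representative in \<open>{1..n}\<close> of an integer index modulo \<open>n\<close>.\<close>

definition cyc_index :: "nat \<Rightarrow> int \<Rightarrow> int" where
  "cyc_index n j = (j - 1) mod int n + 1"

lemma cyc_index_in: "n \<ge> 1 \<Longrightarrow> cyc_index n j \<in> {1..int n}"
  using pos_mod_bound [of "int n" "j - 1"] pos_mod_sign [of "int n" "j - 1"]
  unfolding cyc_index_def atLeastAtMost_iff by linarith

lemma cyc_index_id: "j \<in> {1..int n} \<Longrightarrow> cyc_index n j = j"
  by (simp add: cyc_index_def)

lemma cyc_index_mod: "cyc_index n j mod int n = j mod int n"
  unfolding cyc_index_def mod_add_left_eq by simp

lemma cyc_index_add: "cyc_index n (cyc_index n j + k) = cyc_index n (j + k)"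
proof -
  have "cyc_index n (cyc_index n j + k) = ((j - 1) mod int n + k) mod int n + 1"
    unfolding cyc_index_def by (rule arg_cong [where f = "\<lambda>x. x mod int n + 1"]) simp
  also have "\<dots> = (j - 1 + k) mod int n + 1"
    by (rule arg_cong [where f = "\<lambda>x. x + 1"], rule mod_add_left_eq)
  finally show ?thesis
    unfolding cyc_index_def by (simp only: diff_add_eq)
qed

text \<open>
  The semidirect product of \<open>G\<^sup>n\<close> and \<open>\<int>\<close> for the cyclic shift.  An element
  \<open>(g\<^sub>1, \<dots>, g\<^sub>n, k)\<close> is the pair of the extensional function \<open>i \<mapsto> g\<^sub>i\<close> on \<open>{1..n}\<close>
  and \<open>k\<close>; the integer of the right factor shifts the coordinates of the left one.
\<close>

definition wreath_int :: "('a, 'b) monoid_scheme \<Rightarrow> nat \<Rightarrow> ((int \<Rightarrow> 'a) \<times> int) monoid" where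
  "wreath_int G n =
    \<lparr>carrier = carrier (product_group {1..int n} (\<lambda>_. G)) \<times> UNIV,
     monoid.mult = (\<lambda>(a, k) (b, p).
        (\<lambda>i\<in>{1..int n}. a (cyc_index n (i + p)) \<otimes>\<^bsub>G\<^esub> b i, k + p)),
     one = (\<one>\<^bsub>product_group {1..int n} (\<lambda>_. G)\<^esub>, 0)\<rparr>"

lemma group_wreath_int:
  fixes G (structure)
  assumes "group G" and "n \<ge> 1"
  shows "group (wreath_int G n)"
proof -
  interpret group G by fact
  note idx = cyc_index_in [OF assms(2)]
  define C where "C = (\<Pi>\<^sub>E i\<in>{1..int n}. carrier G)"
  have car: "carrier (wreath_int G n) = C \<times> UNIV"
    by (simp add: wreath_int_def C_def)
  have mult: "(a, k) \<otimes>\<^bsub>wreath_int G n\<^esub> (b, p) =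
      (\<lambda>i\<in>{1..int n}. a (cyc_index n (i + p)) \<otimes> b i, k + p)" for a k b p
    by (simp add: wreath_int_def)
  have unit: "\<one>\<^bsub>wreath_int G n\<^esub> = (\<lambda>i\<in>{1..int n}. \<one>, 0)"
    by (simp add: wreath_int_def)
  have cl: "a i \<in> carrier G" if "a \<in> C" "i \<in> {1..int n}" for a i
    using that unfolding C_def by (rule PiE_mem)
  have CI: "(\<lambda>i\<in>{1..int n}. f i) \<in> C" if "\<And>i. i \<in> {1..int n} \<Longrightarrow> f i \<in> carrier G" for f
    using that unfolding C_def by auto
  have C_restrict: "(\<lambda>i\<in>{1..int n}. a i) = a" if "a \<in> C" for a
    using that unfolding C_def by (rule PiE_restrict)
  show ?thesis
  proof (rule groupI)
    fix x y assume "x \<in> carrier (wreath_int G n)" "y \<in> carrier (wreath_int G n)"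
    then obtain a k b p where "x = (a, k)" "y = (b, p)" "a \<in> C" "b \<in> C"
      unfolding car by blast
    then show "x \<otimes>\<^bsub>wreath_int G n\<^esub> y \<in> carrier (wreath_int G n)"
      using idx cl by (simp only: car mult) (blast intro: CI m_closed)
  next
    show "\<one>\<^bsub>wreath_int G n\<^esub> \<in> carrier (wreath_int G n)"
      unfolding car unit by (blast intro: CI)
  next
    fix x y z
    assume "x \<in> carrier (wreath_int G n)" "y \<in> carrier (wreath_int G n)"
      "z \<in> carrier (wreath_int G n)"
    then obtain a k b p c q where eqs: "x = (a, k)" "y = (b, p)" "z = (c, q)"
      and C: "a \<in> C" "b \<in> C" "c \<in> C"
      unfolding car by blast
    have "(\<lambda>j\<in>{1..int n}. a (cyc_index n (j + p)) \<otimes> b j) (cyc_index n (i + q)) \<otimes> c i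
        = a (cyc_index n (i + (p + q))) \<otimes> (b (cyc_index n (i + q)) \<otimes> c i)"
      if i: "i \<in> {1..int n}" for i
    proof -
      have "cyc_index n (cyc_index n (i + q) + p) = cyc_index n (i + (p + q))"
        unfolding cyc_index_add by (simp only: add.assoc add.commute [of p q])
      then show ?thesis
        by (simp only: restrict_apply' [OF idx] m_assoc cl [OF C(1) idx] cl [OF C(2) idx]
            cl [OF C(3) i])
    qed
    then show "x \<otimes>\<^bsub>wreath_int G n\<^esub> y \<otimes>\<^bsub>wreath_int G n\<^esub> z
        = x \<otimes>\<^bsub>wreath_int G n\<^esub> (y \<otimes>\<^bsub>wreath_int G n\<^esub> z)"
      unfolding eqs mult by (auto simp only: add.assoc restrict_apply' intro!: restrict_ext)
  next
    fix x assume "x \<in> carrier (wreath_int G n)"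
    then obtain a k where x: "x = (a, k)" and a: "a \<in> C"
      unfolding car by blast
    have "(\<lambda>i\<in>{1..int n}. (\<lambda>i\<in>{1..int n}. \<one>) (cyc_index n (i + k)) \<otimes> a i)
        = (\<lambda>i\<in>{1..int n}. a i)"
      by (rule restrict_ext) (simp only: restrict_apply' [OF idx] l_one cl [OF a])
    then show "\<one>\<^bsub>wreath_int G n\<^esub> \<otimes>\<^bsub>wreath_int G n\<^esub> x = x"
      by (simp only: x unit mult C_restrict [OF a] add_0)
  next
    fix x assume "x \<in> carrier (wreath_int G n)"
    then obtain a k where x: "x = (a, k)" and a: "a \<in> C"
      unfolding car by blast
    let ?b = "\<lambda>i\<in>{1..int n}. inv (a (cyc_index n (i - k)))"
    have "(?b, - k) \<in> carrier (wreath_int G n)"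
      unfolding car using idx cl [OF a] by (blast intro: CI inv_closed)
    moreover have "(?b, - k) \<otimes>\<^bsub>wreath_int G n\<^esub> x = \<one>\<^bsub>wreath_int G n\<^esub>"
    proof -
      have "?b (cyc_index n (i + k)) \<otimes> a i = \<one>" if i: "i \<in> {1..int n}" for i
      proof -
        have "cyc_index n (cyc_index n (i + k) - k) = i"
          using cyc_index_add [of n "i + k" "- k"] cyc_index_id [OF i] by simp
        then show ?thesis
          by (simp only: restrict_apply' [OF idx] l_inv cl [OF a i])
      qed
      then show ?thesis
        unfolding x mult unit by (simp cong: restrict_cong)
    qed
    ultimately show "\<exists>y\<in>carrier (wreath_int G n).
        y \<otimes>\<^bsub>wreath_int G n\<^esub> x = \<one>\<^bsub>wreath_int G n\<^esub>" by blast
  qed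
qed

end

theory Submission
  imports Defs "HOL-Algebra.FiniteProduct"
begin

text \<open>
  The map \<open>(g\<^sub>1, \<dots>, g\<^sub>n, k) \<mapsto> ([g\<^sub>1]\<cdots>[g\<^sub>n], k)\<close> is a homomorphism onto \<open>G/[G,G] \<times> \<int>\<close>, because a
  cyclic shift does not change a product in an abelian group.  Its target is abelian, so its kernel
  contains the commutator subgroup.  Conversely, let \<open>\<pi>\<close> be the abelianization map of the wreath
  product.  The \<open>n\<close> coordinate embeddings of \<open>G\<close> are conjugate under \<open>\<int>\<close>, so they become equal
  after composition with \<open>\<pi>\<close>, to a homomorphism which factors through \<open>G/[G,G]\<close>.  Hence
  \<open>\<pi> (g\<^sub>1, \<dots>, g\<^sub>n, 0)\<close> depends only on \<open>[g\<^sub>1]\<cdots>[g\<^sub>n]\<close>, and the kernel lies in the commutator subgroup.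
\<close>

section \<open>Abelian groups, homomorphisms and cyclic indices\<close>

lemma comm_group_DirProd:
  assumes "comm_group G" and "comm_group H"
  shows "comm_group (G \<times>\<times> H)"
proof -
  interpret G: comm_group G by fact
  interpret H: comm_group H by fact
  show ?thesis
    by (rule group.group_comm_groupI [OF DirProd_group])
      (auto simp: DirProd_def G.m_comm H.m_comm)
qed

text \<open>A homomorphism carries the derived subgroup onto the derived subgroup of its image,
  which is trivial in an abelian target.\<close>

lemma (in group_hom) derived_subset_kernel:
  assumes "comm_group H"
  shows "derived G (carrier G) \<subseteq> kernel G H h"
proof -
  have "h ` derived G (carrier G) = derived H (h ` carrier G)"
    by (rule derived_img [symmetric]) simp
  also have "\<dots> = {\<one>\<^bsub>H\<^esub>}"
    by (rule comm_group.derived_eq_singleton [OF assms]) auto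
  finally have "h ` derived G (carrier G) = {\<one>\<^bsub>H\<^esub>}" .
  moreover have "derived G (carrier G) \<subseteq> carrier G"
    by (rule G.derived_in_carrier) simp
  ultimately show ?thesis
    by (auto simp: kernel_def)
qed

lemma hom_finprod:
  assumes "comm_group G" and "comm_group H" and h: "h \<in> hom G H" and "f \<in> S \<rightarrow> carrier G"
  shows "h (finprod G f S) = finprod H (\<lambda>i. h (f i)) S"
proof -
  interpret G: comm_group G by fact
  interpret H: comm_group H by fact
  interpret group_hom G H h
    by unfold_locales (rule h)
  show ?thesis
    using \<open>f \<in> S \<rightarrow> carrier G\<close>
  \<comment> \<open>Over an infinite set \<open>finprod\<close> is the identity by convention, so
    \<open>S\<close> may be arbitrary.\<close>
  proof (induction S rule: infinite_finite_induct)
    case (insert x S)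
    moreover from insert.prems have "f \<in> S \<rightarrow> carrier G" "f x \<in> carrier G"
      by auto
    moreover from this have "(\<lambda>i. h (f i)) \<in> S \<rightarrow> carrier H"
      by (blast intro: hom_closed)
    ultimately show ?case
      by simp
  qed auto
qed

text \<open>The shift by \<open>- p\<close> is the inverse. This allows products over all
  coordinates to be reindexed.\<close>

lemma bij_betw_cyc_index:
  assumes "n \<ge> 1"
  shows "bij_betw (\<lambda>i. cyc_index n (i + p)) {1..int n} {1..int n}"
proof (rule bij_betw_byWitness [where f' = "\<lambda>i. cyc_index n (i - p)"])
  show "\<forall>i\<in>{1..int n}. cyc_index n (cyc_index n (i + p) - p) = i"
    using cyc_index_add [of n _ "- p"] cyc_index_id by simp
  show "\<forall>i\<in>{1..int n}. cyc_index n (cyc_index n (i - p) + p) = i"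
    using cyc_index_add [of n "_ - p" p] cyc_index_id by simp
qed (use cyc_index_in [OF assms] in auto)

section \<open>Coordinate embeddings and shifts in the wreath product\<close>

locale int_wreath = group G for G (structure) +
  fixes n :: nat
  assumes n_pos: "n \<ge> 1"
begin

abbreviation "W \<equiv> wreath_int G n"

abbreviation "I \<equiv> {1..int n}"

text \<open>The embedding of \<open>G\<close> as the \<open>i\<close>-th coordinate; for
  \<open>i\<close> outside \<open>I\<close> it degenerates to the trivial map.\<close>

definition base :: "int \<Rightarrow> 'a \<Rightarrow> (int \<Rightarrow> 'a) \<times> int" where
  "base i g = (\<lambda>j\<in>I. if j = i then g else \<one>, 0)"

definition shift :: "int \<Rightarrow> (int \<Rightarrow> 'a) \<times> int" where
  "shift k = (\<lambda>j\<in>I. \<one>, k)"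

lemma group_W: "group W"
  by (rule group_wreath_int [OF is_group n_pos])

lemma carrier_W: "carrier W = (I \<rightarrow>\<^sub>E carrier G) \<times> UNIV"
  by (simp add: wreath_int_def)

lemma mult_W:
  "(a, k) \<otimes>\<^bsub>W\<^esub> (b, p) = (\<lambda>i\<in>I. a (cyc_index n (i + p)) \<otimes> b i, k + p)"
  by (simp add: wreath_int_def)

text \<open>Only the integer of the right factor shifts coordinates, so \<open>k\<close> is
  arbitrary here.\<close>

lemma mult_W_zero: "(a, k) \<otimes>\<^bsub>W\<^esub> (b, 0) = (\<lambda>i\<in>I. a i \<otimes> b i, k)"
  by (auto simp: mult_W cyc_index_id intro: restrict_ext)

lemma one_W: "\<one>\<^bsub>W\<^esub> = (\<lambda>i\<in>I. \<one>, 0)"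
  by (simp add: wreath_int_def)

lemma base_closed: "g \<in> carrier G \<Longrightarrow> base i g \<in> carrier W"
  by (auto simp: base_def carrier_W)

lemma shift_closed: "shift k \<in> carrier W"
  by (auto simp: shift_def carrier_W)

lemma base_mult:
  assumes "g \<in> carrier G" "h \<in> carrier G"
  shows "base i (g \<otimes> h) = base i g \<otimes>\<^bsub>W\<^esub> base i h"
  unfolding base_def mult_W_zero using assms by (auto intro: restrict_ext)

text \<open>Conjugacy of the \<open>i\<close>-th and the first embedding, written without inverses:
  multiplying by \<open>shift (i - 1)\<close> on the right moves the entry at position
  \<open>i\<close> to position 1.\<close>

lemma base_shift:
  assumes i: "i \<in> I" and g: "g \<in> carrier G"
  shows "base i g \<otimes>\<^bsub>W\<^esub> shift (i - 1) = shift (i - 1) \<otimes>\<^bsub>W\<^esub> base 1 g"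
proof -
  have "cyc_index n (j + (i - 1)) = i \<longleftrightarrow> j = 1" if j: "j \<in> I" for j
  proof
    assume "cyc_index n (j + (i - 1)) = i"
    \<comment> \<open>Shifting back by \<open>1 - i\<close> recovers \<open>j\<close>; the index on
      the left is that of 1, which lies in \<open>I\<close> because
      \<open>n \<ge> 1\<close>.\<close>
    then have "cyc_index n (i + (1 - i)) = j"
      using cyc_index_add [of n "j + (i - 1)" "1 - i"] cyc_index_id [OF j] by simp
    then show "j = 1"
      using n_pos by (simp add: cyc_index_id)
  qed (use cyc_index_id [OF i] in simp)
  moreover have "cyc_index n (j + (i - 1)) \<in> I" for j
    by (rule cyc_index_in [OF n_pos])
  ultimately show ?thesis
    unfolding base_def shift_def mult_W_zero
    unfolding mult_W using g by (auto intro!: restrict_ext simp del: atLeastAtMost_iff)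
qed

section \<open>Homomorphisms from the wreath product to an abelian group\<close>

context
  fixes B (structure) and f
  assumes comm_B: "comm_group B" and f: "f \<in> hom W B"
begin

lemma hom_base: "(\<lambda>g. f (base i g)) \<in> hom G B"
  using f by (auto simp: hom_def base_closed base_mult)

text \<open>Conjugate elements have the same image in an abelian group: the image of the shift in
  \<open>base_shift\<close> commutes and cancels.\<close>

lemma hom_base_eq:
  assumes "i \<in> I" "g \<in> carrier G"
  shows "f (base i g) = f (base 1 g)"
proof -
  interpret B: comm_group B by (rule comm_B)
  have cl: "f x \<in> carrier B" if "x \<in> carrier W" for x
    using f that by (rule hom_in_carrier)
  have "f (base i g) \<otimes>\<^bsub>B\<^esub> f (shift (i - 1)) = f (shift (i - 1)) \<otimes>\<^bsub>B\<^esub> f (base 1 g)"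
    using arg_cong [OF base_shift [OF assms], of f] assms
    by (simp only: hom_mult [OF f] base_closed shift_closed)
  also have "\<dots> = f (base 1 g) \<otimes>\<^bsub>B\<^esub> f (shift (i - 1))"
    using assms by (intro B.m_comm cl base_closed shift_closed)
  finally show ?thesis
    using assms by (simp only: B.right_cancel cl base_closed shift_closed)
qed

text \<open>An element with integer part 0 is the product of its embedded coordinates, and
  \<open>hom_base_eq\<close> moves each of them to the first coordinate.\<close>

lemma hom_eq_finprod:
  assumes a: "a \<in> I \<rightarrow>\<^sub>E carrier G"
  shows "f (a, 0) = finprod B (\<lambda>i. f (base 1 (a i))) I"
proof -
  interpret W: group W by (rule group_W)
  interpret B: comm_group B by (rule comm_B)
  interpret f: group_hom W B f
    by unfold_locales (rule f)
  have a_cl: "a i \<in> carrier G" if "i \<in> I" for i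
    using a that by (rule PiE_mem)
  \<comment> \<open>Induction on the set \<open>S\<close> of coordinates that are kept, the others
    being reset to the identity; \<open>S = I\<close> gives the claim.\<close>
  have *: "f (\<lambda>i\<in>I. if i \<in> S then a i else \<one>\<^bsub>G\<^esub>, 0) = finprod B (\<lambda>i. f (base 1 (a i))) S"
    if "finite S" "S \<subseteq> I" for S
    using that
  proof (induction S rule: finite_induct)
    case empty
    then show ?case
      using f.hom_one by (simp only: one_W empty_iff if_False B.finprod_empty)
  next
    case (insert x S)
    then have x: "x \<in> I" and S: "S \<subseteq> I"
      by auto
    let ?a = "\<lambda>S. (\<lambda>i\<in>I. if i \<in> S then a i else \<one>\<^bsub>G\<^esub>, 0::int)"
    \<comment> \<open>Since \<open>x\<close> is not in \<open>S\<close>, each coordinate has at most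
      one nontrivial factor.\<close>
    have "?a (insert x S) = base x (a x) \<otimes>\<^bsub>W\<^esub> ?a S"
      unfolding base_def mult_W_zero using insert.hyps a_cl x
      by (auto intro!: restrict_ext simp del: atLeastAtMost_iff)
    moreover have "?a S \<in> carrier W"
      using a_cl by (auto simp: carrier_W simp del: atLeastAtMost_iff)
    ultimately have "f (?a (insert x S)) = f (base x (a x)) \<otimes>\<^bsub>B\<^esub> f (?a S)"
      using a_cl [OF x] by (simp add: base_closed)
    also have "\<dots> = f (base 1 (a x)) \<otimes>\<^bsub>B\<^esub> finprod B (\<lambda>i. f (base 1 (a i))) S"
      by (simp only: hom_base_eq [OF x a_cl [OF x]] insert.IH [OF S])
    also have "\<dots> = finprod B (\<lambda>i. f (base 1 (a i))) (insert x S)"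
      using insert.hyps a_cl x S
      by (intro B.finprod_insert [symmetric]) (auto simp: base_closed simp del: atLeastAtMost_iff)
    finally show ?case .
  qed
  have "(\<lambda>i\<in>I. if i \<in> I then a i else \<one>\<^bsub>G\<^esub>) = a"
    using PiE_restrict [OF a] by (simp cong: restrict_cong del: atLeastAtMost_iff)
  then show ?thesis
    using * [of I] by simp
qed

end

section \<open>The map onto the abelian target and its kernel\<close>

abbreviation "D \<equiv> derived G (carrier G)"

text \<open>Coordinates pass to the quotient before being multiplied, because \<open>finprod\<close>
  is a product in a commutative structure.\<close>

definition abel :: "(int \<Rightarrow> 'a) \<times> int \<Rightarrow> 'a set \<times> int" where
  "abel = (\<lambda>(a, k). (finprod (G Mod D) (\<lambda>i. D #> a i) I, k))"

lemma comm_target: "comm_group ((G Mod D) \<times>\<times> integer_group)"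
  by (rule comm_group_DirProd [OF derived_quot_is_comm_group abelian_integer_group])

lemma quot_hom: "(\<lambda>g. D #> g) \<in> hom G (G Mod D)"
  by (rule normal.r_coset_hom_Mod [OF derived_self_is_normal])

lemma quot_closed: "g \<in> carrier G \<Longrightarrow> D #> g \<in> carrier (G Mod D)"
  by (rule hom_in_carrier [OF quot_hom])

lemma abel_hom: "abel \<in> hom W ((G Mod D) \<times>\<times> integer_group)"
proof (rule homI)
  interpret A: comm_group "G Mod D" by (rule derived_quot_is_comm_group)
  fix x assume "x \<in> carrier W"
  then show "abel x \<in> carrier ((G Mod D) \<times>\<times> integer_group)"
    unfolding carrier_W abel_def
    by (auto simp del: atLeastAtMost_iff intro!: A.finprod_closed quot_closed)
next
  interpret A: comm_group "G Mod D" by (rule derived_quot_is_comm_group)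
  fix x y assume "x \<in> carrier W" "y \<in> carrier W"
  then obtain a k b p where xy: "x = (a, k)" "y = (b, p)"
    and a: "a \<in> I \<rightarrow>\<^sub>E carrier G" and b: "b \<in> I \<rightarrow>\<^sub>E carrier G"
    unfolding carrier_W by blast
  let ?\<sigma> = "\<lambda>i. cyc_index n (i + p)"
  have a_cl: "a i \<in> carrier G" and b_cl: "b i \<in> carrier G" if "i \<in> I" for i
    using a b that by auto
  have \<sigma>: "?\<sigma> i \<in> I" for i
    by (rule cyc_index_in [OF n_pos])
  have bij: "bij_betw ?\<sigma> I I"
    by (rule bij_betw_cyc_index [OF n_pos])
  have "finprod (G Mod D) (\<lambda>i. D #> (\<lambda>i\<in>I. a (?\<sigma> i) \<otimes> b i) i) I
      = finprod (G Mod D) (\<lambda>i. (D #> a (?\<sigma> i)) \<otimes>\<^bsub>G Mod D\<^esub> (D #> b i)) I"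
    by (rule A.finprod_cong')
      (auto simp: hom_mult [OF quot_hom] quot_closed a_cl [OF \<sigma>] b_cl
        simp del: atLeastAtMost_iff mult_FactGroup)
  also have "\<dots> = finprod (G Mod D) (\<lambda>i. D #> a (?\<sigma> i)) I
      \<otimes>\<^bsub>G Mod D\<^esub> finprod (G Mod D) (\<lambda>i. D #> b i) I"
    by (rule A.finprod_multf) (use quot_closed a_cl [OF \<sigma>] b_cl in blast)+
  \<comment> \<open>The shift permutes the factors coming from \<open>a\<close>, so reindexing along
    \<open>?\<sigma>\<close> removes it.\<close>
  also have "finprod (G Mod D) (\<lambda>i. D #> a (?\<sigma> i)) I
      = finprod (G Mod D) (\<lambda>i. D #> a i) (?\<sigma> ` I)"
    by (rule A.finprod_reindex [symmetric])
      (use bij quot_closed a_cl \<sigma> in \<open>auto simp: bij_betw_def\<close>)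
  also have "?\<sigma> ` I = I"
    using bij by (rule bij_betw_imp_surj_on)
  finally show "abel (x \<otimes>\<^bsub>W\<^esub> y) = abel x \<otimes>\<^bsub>(G Mod D) \<times>\<times> integer_group\<^esub> abel y"
    by (simp add: xy mult_W abel_def del: mult_FactGroup)
qed

lemma abel_surj: "abel ` carrier W = carrier ((G Mod D) \<times>\<times> integer_group)"
proof
  show "abel ` carrier W \<subseteq> carrier ((G Mod D) \<times>\<times> integer_group)"
    using hom_in_carrier [OF abel_hom] by blast
next
  interpret A: comm_group "G Mod D" by (rule derived_quot_is_comm_group)
  show "carrier ((G Mod D) \<times>\<times> integer_group) \<subseteq> abel ` carrier W"
  proof
    fix y assume "y \<in> carrier ((G Mod D) \<times>\<times> integer_group)"
    then obtain g k where g: "g \<in> carrier G" and y: "y = (D #> g, k)"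
      by (auto simp: carrier_FactGroup)
    \<comment> \<open>One nontrivial coordinate suffices: the product of the classes is then the
      class of \<open>g\<close>.\<close>
    let ?a = "\<lambda>j\<in>I. if j = 1 then g else \<one>"
    have one: "D #> \<one> = \<one>\<^bsub>G Mod D\<^esub>"
      by (rule hom_one [OF quot_hom is_group A.is_group])
    have "finprod (G Mod D) (\<lambda>i. D #> ?a i) I
        = finprod (G Mod D) (\<lambda>i. if i = 1 then D #> g else \<one>\<^bsub>G Mod D\<^esub>) I"
      by (rule A.finprod_cong')
        (use quot_closed [OF g] one in \<open>auto simp del: one_FactGroup\<close>)
    also have "\<dots> = D #> g"
      by (rule A.finprod_singleton_swap) (use n_pos quot_closed [OF g] in auto)
    finally have "abel (?a, k) = y"
      by (simp add: abel_def y)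
    moreover have "(?a, k) \<in> carrier W"
      using g by (auto simp: carrier_W)
    ultimately show "y \<in> abel ` carrier W"
      by blast
  qed
qed

lemma kernel_abel: "kernel W ((G Mod D) \<times>\<times> integer_group) abel = derived W (carrier W)"
proof
  interpret W: group W by (rule group_W)
  interpret T: comm_group "(G Mod D) \<times>\<times> integer_group" by (rule comm_target)
  interpret abel: group_hom W "(G Mod D) \<times>\<times> integer_group" abel
    by unfold_locales (rule abel_hom)
  show "derived W (carrier W) \<subseteq> kernel W ((G Mod D) \<times>\<times> integer_group) abel"
    by (rule abel.derived_subset_kernel [OF comm_target])
next
  let ?N = "derived W (carrier W)"
  let ?\<pi> = "\<lambda>x. ?N #>\<^bsub>W\<^esub> x"
  interpret W: group W by (rule group_W)
  interpret A: comm_group "G Mod D" by (rule derived_quot_is_comm_group)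
  interpret B: comm_group "W Mod ?N" by (rule W.derived_quot_is_comm_group)
  have \<pi>: "?\<pi> \<in> hom W (W Mod ?N)"
    by (rule normal.r_coset_hom_Mod [OF W.derived_self_is_normal])
  interpret h: group_hom G "W Mod ?N" "\<lambda>g. ?\<pi> (base 1 g)"
    by unfold_locales (rule hom_base [OF B.comm_group_axioms \<pi>])
  \<comment> \<open>The first embedding followed by \<open>?\<pi>\<close> has an abelian target, so
    it kills \<open>D\<close> and factors through the quotient.\<close>
  obtain h' where h': "h' \<in> hom (G Mod D) (W Mod ?N)"
    and h'_eq: "\<And>g. g \<in> carrier G \<Longrightarrow> h' (D #> g) = ?\<pi> (base 1 g)"
    using h.FactGroup_universal_kernel [OF derived_self_is_normal
        h.derived_subset_kernel [OF B.comm_group_axioms]] by blast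
  show "kernel W ((G Mod D) \<times>\<times> integer_group) abel \<subseteq> ?N"
  proof
    fix x assume "x \<in> kernel W ((G Mod D) \<times>\<times> integer_group) abel"
    then obtain a where x: "x = (a, 0)" "x \<in> carrier W" and a: "a \<in> I \<rightarrow>\<^sub>E carrier G"
      and prod: "finprod (G Mod D) (\<lambda>i. D #> a i) I = \<one>\<^bsub>G Mod D\<^esub>"
      by (auto simp: kernel_def abel_def carrier_W)
    have a_cl: "a i \<in> carrier G" if "i \<in> I" for i
      using a that by (rule PiE_mem)
    \<comment> \<open>This chain writes \<open>?\<pi> x\<close> as \<open>h'\<close> of the first
      component of \<open>abel x\<close>, which is trivial.\<close>
    have "?\<pi> x = finprod (W Mod ?N) (\<lambda>i. ?\<pi> (base 1 (a i))) I"
      unfolding x(1) by (rule hom_eq_finprod [OF B.comm_group_axioms \<pi> a])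
    also have "\<dots> = finprod (W Mod ?N) (\<lambda>i. h' (D #> a i)) I"
      by (rule B.finprod_cong')
        (use a_cl h'_eq hom_in_carrier [OF h'] quot_closed in \<open>auto simp del: atLeastAtMost_iff\<close>)
    also have "\<dots> = h' (finprod (G Mod D) (\<lambda>i. D #> a i) I)"
      by (rule hom_finprod [OF A.comm_group_axioms B.comm_group_axioms h', symmetric])
        (use a_cl quot_closed in blast)
    also have "\<dots> = ?N"
      unfolding prod using hom_one [OF h' A.is_group B.is_group] by simp
    finally show "x \<in> ?N"
      \<comment> \<open>The coset of \<open>x\<close> has been shown to be \<open>?N\<close>, and
        \<open>x\<close> lies in its own coset.\<close>
      using W.rcos_self [OF x(2) W.derived_is_subgroup [OF subset_refl]] by simp
  qed
qed

end

theorem theorem3p2: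
  fixes G :: "('a, 'b) monoid_scheme" and n :: nat
  assumes "group G" and "n \<ge> 1"
  shows "wreath_int G n Mod derived (wreath_int G n) (carrier (wreath_int G n))
           \<cong> (G Mod derived G (carrier G)) \<times>\<times> integer_group"
proof -
  interpret int_wreath G n
    using assms by (simp add: int_wreath_def int_wreath_axioms_def)
  interpret W: group W by (rule group_W)
  interpret T: comm_group "(G Mod D) \<times>\<times> integer_group" by (rule comm_target)
  interpret abel: group_hom W "(G Mod D) \<times>\<times> integer_group" abel
    by unfold_locales (rule abel_hom)
  show ?thesis
    \<comment> \<open>First isomorphism theorem for \<open>abel\<close>, with its kernel identified
      as the derived subgroup.\<close>
    using abel.FactGroup_iso [OF abel_surj] by (simp only: kernel_abel)
qed

end
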